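(* For any cardinal $\lambda$, any $\gamma$-saturated normal uniform ideal $J$ on a cardinal $\kappa$ with $\gamma<\kappa$, and any $m,n\in\omega$, the Cohen forcing $\mathrm{Add}(\omega,\lambda)$ is $J^n$-$m$-linked.
   Context: $\mathrm{Add}(\omega,\lambda)$ is the standard poset of finite partial functions adding $\lambda$ Cohen reals, ordered by reverse inclusion. All ideals are proper ($\kappa\notin J$) and uniform ($[\kappa]^{<\kappa}\subseteq J$); $J^*$ is the dual filter, $J^+$ the positive sets; normality is in the usual sense. $J$ is $\gamma$-saturated if for every $\langle X_i:i<\gamma\rangle\subseteq J^+$ there are $i<j<\gamma$ with $X_i\cap X_j\in J^+$. For $n\ge1$, $[\kappa]^n$ is the set of strictly increasing $n$-tuples from $\kappa$, identified with $n$-element subsets. Fubini powers: $J^0=\{\emptyset\}$ on $[\kappa]^0=\{\emptyset\}$, $J^1=J$, and for $n\ge2$, $X\subseteq[\kappa]^n$ is in $J^n$ iff $\{\alpha:\{\bar\beta\in[\kappa]^{n-1}:(\alpha,\bar\beta)\in X\}\in J^{n-1}\}\in J^*$; $(J^n)^+$ denotes the $J^n$-positive sets. For $a,b\in[\kappa]^n$, $a\simeq b$ means the order-preserving bijection from $a$ onto $b$ is the identity on $a\cap b$. A poset $P$ is $J^n$-$m$-linked if for every $X\in(J^n)^+$ and every $\langle p_a\in P:a\in X\rangle$ there is $Y\subseteq X$ with $Y\in(J^n)^+$ such that whenever $k\le m$ and $a_0,\dots,a_{k-1}\in Y$ are pairwise $\simeq$, the conditions $p_{a_0},\dots,p_{a_{k-1}}$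 have a common lower bound in $P$. *)

theory Defs
  imports Main
begin

unbundle cardinal_syntax

text \<open>
  A cardinal \<open>\<kappa>\<close> is given by a relation \<open>r\<close> with \<^term>\<open>Card_order r\<close>: the set underlying
  \<open>\<kappa>\<close> is \<^term>\<open>Field r\<close>, and \<open>(\<alpha>, \<beta>) \<in> r\<close> means \<open>\<alpha> \<le> \<beta>\<close>.
\<close>

definition slt :: "'k rel \<Rightarrow> 'k \<Rightarrow> 'k \<Rightarrow> bool" where
  "slt r \<alpha> \<beta> \<longleftrightarrow> (\<alpha>, \<beta>) \<in> r \<and> \<alpha> \<noteq> \<beta>"

definition ideal_on :: "'a set \<Rightarrow> 'a set set \<Rightarrow> bool" where
  "ideal_on K J \<longleftrightarrow>
     J \<subseteq> Pow K \<and> {} \<in> J \<and> K \<notin> J \<and>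
     (\<forall>X\<in>J. \<forall>Y. Y \<subseteq> X \<longrightarrow> Y \<in> J) \<and>
     (\<forall>X\<in>J. \<forall>Y\<in>J. X \<union> Y \<in> J)"

definition uniform_ideal :: "'k rel \<Rightarrow> 'k set set \<Rightarrow> bool" where
  "uniform_ideal r J \<longleftrightarrow> ideal_on (Field r) J \<and> (\<forall>X. X \<subseteq> Field r \<and> |X| <o r \<longrightarrow> X \<in> J)"

definition dual_filter :: "'a set \<Rightarrow> 'a set set \<Rightarrow> 'a set set" where
  "dual_filter K J = {X. X \<subseteq> K \<and> K - X \<in> J}"

definition positive_sets :: "'a set \<Rightarrow> 'a set set \<Rightarrow> 'a set set" where
  "positive_sets K J = {X. X \<subseteq> K \<and> X \<notin> J}"

definition diagonal_union :: "'k rel \<Rightarrow> ('k \<Rightarrow> 'k set) \<Rightarrow> 'k set" where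
  "diagonal_union r X = {\<beta> \<in> Field r. \<exists>\<alpha>. slt r \<alpha> \<beta> \<and> \<beta> \<in> X \<alpha>}"

definition normal_ideal :: "'k rel \<Rightarrow> 'k set set \<Rightarrow> bool" where
  "normal_ideal r J \<longleftrightarrow> (\<forall>X. (\<forall>\<alpha>\<in>Field r. X \<alpha> \<in> J) \<longrightarrow> diagonal_union r X \<in> J)"

text \<open>The length \<open>\<gamma>\<close> of the sequences is an ordinal, given by a well-order \<open>s\<close>.\<close>

definition saturated :: "'g rel \<Rightarrow> 'a set \<Rightarrow> 'a set set \<Rightarrow> bool" where
  "saturated s K J \<longleftrightarrow>
     (\<forall>X. (\<forall>i\<in>Field s. X i \<in> positive_sets K J) \<longrightarrow>
          (\<exists>i j. slt s i j \<and> X i \<inter> X j \<in> positive_sets K J))"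

text \<open>
  Elements of \<open>[\<kappa>]\<^sup>n\<close> are strictly increasing lists of length \<open>n\<close>; the corresponding
  \<open>n\<close>-element subset of \<open>\<kappa>\<close> is obtained by \<^const>\<open>set\<close>.
\<close>

definition tuples :: "'k rel \<Rightarrow> nat \<Rightarrow> 'k list set" where
  "tuples r n = {a. length a = n \<and> set a \<subseteq> Field r \<and> sorted_wrt (slt r) a}"

fun fubini_power :: "'k rel \<Rightarrow> 'k set set \<Rightarrow> nat \<Rightarrow> 'k list set set" where
  "fubini_power r J 0 = {{}}"
| "fubini_power r J (Suc 0) = {X. X \<subseteq> tuples r 1 \<and> {\<alpha> \<in> Field r. [\<alpha>] \<in> X} \<in> J}"
| "fubini_power r J (Suc (Suc n)) =
     {X. X \<subseteq> tuples r (Suc (Suc n)) \<and>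
         {\<alpha> \<in> Field r. {b \<in> tuples r (Suc n). \<alpha> # b \<in> X} \<in> fubini_power r J (Suc n)}
           \<in> dual_filter (Field r) J}"

definition tuple_sim :: "'k rel \<Rightarrow> 'k list \<Rightarrow> 'k list \<Rightarrow> bool" where
  "tuple_sim r a b \<longleftrightarrow>
     (\<exists>f. bij_betw f (set a) (set b) \<and> monotone_on (set a) (slt r) (slt r) f \<and>
          (\<forall>x \<in> set a \<inter> set b. f x = x))"

text \<open>A poset is given by its carrier \<open>P\<close> and its order relation \<open>le\<close>.\<close>

definition fubini_linked ::
    "'k rel \<Rightarrow> 'k set set \<Rightarrow> nat \<Rightarrow> nat \<Rightarrow> 'p set \<Rightarrow> 'p rel \<Rightarrow> bool" where
  "fubini_linked r J n m P le \<longleftrightarrow>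
     (\<forall>X \<in> positive_sets (tuples r n) (fubini_power r J n).
      \<forall>p. (\<forall>a\<in>X. p a \<in> P) \<longrightarrow>
        (\<exists>Y. Y \<subseteq> X \<and> Y \<in> positive_sets (tuples r n) (fubini_power r J n) \<and>
          (\<forall>k\<le>m. \<forall>a :: nat \<Rightarrow> 'k list.
             (\<forall>i<k. a i \<in> Y) \<and> (\<forall>i<k. \<forall>j<k. i \<noteq> j \<longrightarrow> tuple_sim r (a i) (a j)) \<longrightarrow>
             (\<exists>q\<in>P. \<forall>i<k. (q, p (a i)) \<in> le))))"

text \<open>
  \<open>Add(\<omega>, \<lambda>)\<close>: finite partial functions from \<open>\<lambda> \<times> \<omega>\<close> to \<open>2\<close>, where \<open>\<lambda>\<close> is given by \<open>t\<close>;
  stronger conditions are smaller.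
\<close>

definition Add_omega :: "'l rel \<Rightarrow> ('l \<times> nat \<rightharpoonup> bool) set" where
  "Add_omega t = {p. finite (dom p) \<and> dom p \<subseteq> Field t \<times> UNIV}"

definition Add_omega_le :: "'l rel \<Rightarrow> ('l \<times> nat \<rightharpoonup> bool) rel" where
  "Add_omega_le t = {(p, q). p \<in> Add_omega t \<and> q \<in> Add_omega t \<and> q \<subseteq>\<^sub>m p}"

lemma partial_order_on_Add_omega: "partial_order_on (Add_omega t) (Add_omega_le t)"
  unfolding partial_order_on_def preorder_on_def refl_on_def trans_def antisym_def
    Add_omega_le_def
  by (auto intro: map_le_trans map_le_antisym)

end

theory Submission
  imports Defs "HOL-Library.Countable"
begin

text \<open>
  Write \<open>F\<close> for the filter dual to \<open>J\<close>. Since a family of pairwise compatible Cohen conditions has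
  a union, only pairs matter. Enumerate the domain of each \<open>p\<^sub>a\<close>; by countable completeness the
  sequence of values can be made independent of \<open>a\<close>. It then suffices to show that two functions
  \<open>f\<close>, \<open>g\<close> with \<open>f a \<noteq> g a\<close> for all \<open>a\<close> in a positive set \<open>X\<close> satisfy \<open>f a \<noteq> g b\<close> for all
  \<open>a \<simeq> b\<close> in some positive \<open>Y \<subseteq> X\<close>.

  Shrink \<open>X\<close> so that \<open>f a = v (a|I)\<close> with \<open>\<Sum>i\<in>I. 2\<^sup>i\<close> minimal among all positive subsets, and
  likewise for \<open>g\<close> and \<open>I'\<close>. For \<open>i \<in> I\<close> and almost every \<open>c = (a\<^sub>0,\<dots>,a\<^sub>i\<^sub>-\<^sub>1)\<close>, no function
  \<open>u\<close> of the coordinates after \<open>i\<close> agrees with \<open>f (c,\<sqdot>)\<close> on a positive set: otherwise saturation of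
  the Fubini powers gives \<open>y\<close> such that \<open>f (c, x, d) = f (c, y, d)\<close> for positively many \<open>(x, d)\<close>, so
  that \<open>i\<close> could be traded for coordinates below \<open>i\<close>. By normality this holds
  simultaneously for all \<open>u\<close> arising from a fixed function by fixing parameters below \<open>a\<^sub>i\<close>. Let
  \<open>f a = g b\<close> with \<open>a \<simeq> b\<close>, and let \<open>i \<in> I\<close>, \<open>j \<in> I'\<close> be the largest coordinates at which \<open>a\<close>
  and \<open>b\<close> differ. If \<open>b\<^sub>j < a\<^sub>i\<close>, then \<open>g b\<close> is such a function \<open>u\<close>, a contradiction; the case
  \<open>a\<^sub>i < b\<^sub>j\<close> is symmetric. If there is no such \<open>i\<close>, then \<open>f a = f b \<noteq> g b\<close>, and similarly for \<open>j\<close>.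
\<close>

subsection \<open>Powers of a filter\<close>

text \<open>The Fubini power on the filter side, with the first coordinate quantified outermost. Its
  lists need not be increasing; \<open>fubini_power_iff\<close> compares it with the ideals on
  subsets of \<open>tuples r n\<close>.\<close>

primrec power_filter :: "'a filter \<Rightarrow> nat \<Rightarrow> 'a list filter" where
  "power_filter F 0 = principal {[]}"
| "power_filter F (Suc k) =
     Abs_filter (\<lambda>P. \<forall>\<^sub>F x in F. \<forall>\<^sub>F b in power_filter F k. P (x # b))"

lemma eventually_power_filter_0 [simp]: "eventually P (power_filter F 0) \<longleftrightarrow> P []"
  by (simp add: eventually_principal)

lemma eventually_power_filter_Suc:
  "eventually P (power_filter F (Suc k)) \<longleftrightarrow>
     (\<forall>\<^sub>F x in F. \<forall>\<^sub>F b in power_filter F k. P (x # b))"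
  unfolding power_filter.simps
proof (rule eventually_Abs_filter, rule is_filter.intro)
  fix P Q :: "'a list \<Rightarrow> bool"
  assume P: "\<forall>\<^sub>F x in F. \<forall>\<^sub>F b in power_filter F k. P (x # b)"
  show "\<forall>\<^sub>F x in F. \<forall>\<^sub>F b in power_filter F k. P (x # b) \<and> Q (x # b)"
    if "\<forall>\<^sub>F x in F. \<forall>\<^sub>F b in power_filter F k. Q (x # b)"
    using P that by eventually_elim (rule eventually_conj)
  show "\<forall>\<^sub>F x in F. \<forall>\<^sub>F b in power_filter F k. Q (x # b)" if "\<forall>x. P x \<longrightarrow> Q x"
    using P by eventually_elim (use that in \<open>auto elim: eventually_mono\<close>)
qed simp

lemma frequently_power_filter_0 [simp]: "frequently P (power_filter F 0) \<longleftrightarrow> P []"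
  by (simp add: frequently_def del: power_filter.simps)

lemma frequently_power_filter_Suc:
  "frequently P (power_filter F (Suc k)) \<longleftrightarrow>
     (\<exists>\<^sub>F x in F. \<exists>\<^sub>F b in power_filter F k. P (x # b))"
  by (simp add: frequently_def eventually_power_filter_Suc del: power_filter.simps)

declare power_filter.simps [simp del]

lemma eventually_power_filter_add:
  "eventually P (power_filter F (i + k)) \<longleftrightarrow>
     (\<forall>\<^sub>F c in power_filter F i. \<forall>\<^sub>F d in power_filter F k. P (c @ d))"
  by (induction i arbitrary: P) (simp_all add: eventually_power_filter_Suc)

lemma frequently_power_filter_add:
  "frequently P (power_filter F (i + k)) \<longleftrightarrow>
     (\<exists>\<^sub>F c in power_filter F i. \<exists>\<^sub>F d in power_filter F k. P (c @ d))"
  by (simp add: frequently_def eventually_power_filter_add)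

lemma eventually_length_power_filter: "\<forall>\<^sub>F c in power_filter F i. length c = i"
  by (induction i) (simp_all add: eventually_power_filter_Suc)

subsection \<open>Saturated normal filters\<close>

lemma slt_trans: "Well_order r \<Longrightarrow> slt r x y \<Longrightarrow> slt r y z \<Longrightarrow> slt r x z"
  unfolding slt_def well_order_on_def linear_order_on_def partial_order_on_def preorder_on_def
  by (metis antisymD transD)

lemma slt_asym: "Well_order r \<Longrightarrow> slt r x y \<Longrightarrow> \<not> slt r y x"
  unfolding slt_def well_order_on_def linear_order_on_def partial_order_on_def
  by (metis antisymD)

lemma slt_linear:
  "Well_order r \<Longrightarrow> x \<in> Field r \<Longrightarrow> y \<in> Field r \<Longrightarrow> x \<noteq> y \<Longrightarrow> slt r x y \<or> slt r y x"
  unfolding slt_def well_order_on_def linear_order_on_def total_on_def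
  by auto

lemma slt_Field: "slt r x y \<Longrightarrow> x \<in> Field r" "slt r x y \<Longrightarrow> y \<in> Field r"
  by (auto simp: slt_def Field_def)

lemma slt_iff_underS: "slt r x y \<longleftrightarrow> x \<in> underS r y"
  by (auto simp: slt_def underS_def)

text \<open>Saturation enters as a bound on almost disjoint families of positive sets indexed by
  points of \<kappa>. Of \<open>M\<close> only the cardinality matters: infinite and below
  \<kappa>.\<close>

locale saturated_filter =
  fixes r :: "'k rel" and F :: "'k filter" and M :: "'m set"
  assumes Card_order: "Card_order r"
    and infinite_M: "infinite M"
    and M_less: "|M| <o r"
    and eventually_Field: "\<forall>\<^sub>F x in F. x \<in> Field r"
    and eventually_notin: "|X| <o r \<Longrightarrow> \<forall>\<^sub>F x in F. x \<notin> X"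
    and eventually_diagonal:
      "(\<And>y. y \<in> Field r \<Longrightarrow> \<forall>\<^sub>F x in F. P y x) \<Longrightarrow> \<forall>\<^sub>F x in F. \<forall>y. slt r y x \<longrightarrow> P y x"
    and card_almost_disjoint:
      "\<Theta> \<subseteq> Field r \<Longrightarrow> (\<And>y. y \<in> \<Theta> \<Longrightarrow> \<exists>\<^sub>F x in F. D y x) \<Longrightarrow>
        (\<And>y z. y \<in> \<Theta> \<Longrightarrow> z \<in> \<Theta> \<Longrightarrow> y \<noteq> z \<Longrightarrow> \<forall>\<^sub>F x in F. \<not> (D y x \<and> D z x)) \<Longrightarrow>
        |\<Theta>| \<le>o |M|"
begin

lemma Well_order: "Well_order r"
  using Card_order by (simp add: card_order_on_def)

lemma natLeq_less: "natLeq <o r"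
  using infinite_M M_less infinite_iff_natLeq_ordLeq ordLeq_ordLess_trans by blast

lemma eventually_slt:
  assumes "y \<in> Field r"
  shows "\<forall>\<^sub>F x in F. slt r y x"
proof -
  have "|{y}| <o r"
    by (rule ordLess_transitive[OF _ natLeq_less]) (simp flip: finite_iff_ordLess_natLeq)
  then have "\<forall>\<^sub>F x in F. x \<notin> {y}"
    by (rule eventually_notin)
  moreover have "\<forall>\<^sub>F x in F. x \<notin> underS r y"
    by (rule eventually_notin) (rule card_of_underS[OF Card_order assms])
  ultimately show ?thesis
    using eventually_Field
    by eventually_elim (use slt_linear[OF Well_order assms] in \<open>auto simp: slt_iff_underS\<close>)
qed

text \<open>Normality yields \<kappa>-completeness: \<open>I\<close> injects into the points below
  some \<open>a\<close>, and for \<open>x\<close> above \<open>a\<close> the diagonal intersection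
  at \<open>x\<close> already runs over all of \<open>I\<close>.\<close>

lemma eventually_Ball_less:
  assumes less: "|I| <o r" and ev: "\<And>i. i \<in> I \<Longrightarrow> \<forall>\<^sub>F x in F. P i x"
  shows "\<forall>\<^sub>F x in F. \<forall>i\<in>I. P i x"
proof -
  obtain a where a: "a \<in> Field r" "|I| =o Restr r (underS r a)"
    using less ordLess_iff_ordIso_Restr[OF Well_order card_of_Well_order] by blast
  have "|Field (Restr r (underS r a))| \<le>o |underS r a|"
    by (rule card_of_mono1) (auto simp: Field_def)
  moreover have "|Field (Restr r (underS r a))| =o |I|"
    by (metis a(2) Field_card_of card_of_cong ordIso_symmetric)
  ultimately have "|I| \<le>o |underS r a|"
    using ordIso_ordLeq_trans ordIso_symmetric by blast
  then obtain h where h: "inj_on h I" "h ` I \<subseteq> underS r a"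
    by (auto simp flip: card_of_ordLeq)
  have "\<forall>\<^sub>F x in F. \<forall>y. slt r y x \<longrightarrow> y \<in> h ` I \<longrightarrow> P (inv_into I h y) x"
    by (rule eventually_diagonal) (auto simp: h ev)
  with eventually_slt[OF a(1)] show ?thesis
  proof eventually_elim
    case (elim x)
    show ?case
    proof
      fix i assume i: "i \<in> I"
      then have "slt r (h i) x"
        using h(2) elim(1) slt_trans[OF Well_order, of "h i" a x]
        by (auto simp: slt_iff_underS[of _ _ a])
      then show "P i x"
        using elim(2) i h(1) by force
    qed
  qed
qed

section \<open>Completeness and normality of the Fubini powers\<close>

lemma eventually_Ball_less_power:
  assumes less: "|I| <o r" and ev: "\<And>i. i \<in> I \<Longrightarrow> \<forall>\<^sub>F x in power_filter F k. P i x"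
  shows "\<forall>\<^sub>F x in power_filter F k. \<forall>i\<in>I. P i x"
  using ev
proof (induction k arbitrary: P)
  case (Suc k)
  then have "\<forall>\<^sub>F x in F. \<forall>i\<in>I. \<forall>\<^sub>F b in power_filter F k. P i (x # b)"
    by (intro eventually_Ball_less less) (simp add: eventually_power_filter_Suc)
  then show ?case
    unfolding eventually_power_filter_Suc by eventually_elim (rule Suc.IH, blast)
qed simp

lemma frequently_Bex_less_power:
  assumes "|I| <o r" and "\<exists>\<^sub>F x in power_filter F k. \<exists>i\<in>I. P i x"
  obtains i where "i \<in> I" "\<exists>\<^sub>F x in power_filter F k. P i x"
  using eventually_Ball_less_power[OF assms(1), where k = k and P = "\<lambda>i x. \<not> P i x"] assms(2)
  unfolding frequently_def by auto

lemma frequently_Bex_less: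
  assumes "|I| <o r" and "\<exists>\<^sub>F x in F. \<exists>i\<in>I. P i x"
  obtains i where "i \<in> I" "\<exists>\<^sub>F x in F. P i x"
  using eventually_Ball_less[OF assms(1), where P = "\<lambda>i x. \<not> P i x"] assms(2)
  unfolding frequently_def by auto

lemma frequently_ex_countable_power:
  fixes P :: "'c::countable \<Rightarrow> 'k list \<Rightarrow> bool"
  assumes "\<exists>\<^sub>F x in power_filter F k. \<exists>i. P i x"
  obtains i where "\<exists>\<^sub>F x in power_filter F k. P i x"
proof -
  have "|UNIV :: 'c set| \<le>o |UNIV :: nat set|"
    by (subst card_of_ordLeq[symmetric]) (use inj_to_nat in blast)
  then have "|UNIV :: 'c set| <o r"
    using card_of_nat natLeq_less ordIso_ordLess_trans ordLeq_ordLess_trans by blast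
  from frequently_Bex_less_power[OF this] show ?thesis
    using assms that by auto
qed

text \<open>Normality in the first coordinate \<open>x\<close> gives, for each \<open>y\<close>
  below \<open>x\<close>, a large set of remaining coordinates. There are fewer than \<kappa> such
  \<open>y\<close>, so completeness intersects these sets.\<close>

lemma eventually_diagonal_power:
  assumes "\<And>y. y \<in> Field r \<Longrightarrow> \<forall>\<^sub>F a in power_filter F (Suc k). P y a"
  shows "\<forall>\<^sub>F a in power_filter F (Suc k). \<forall>y. slt r y (hd a) \<longrightarrow> P y a"
proof -
  have "\<forall>\<^sub>F x in F. \<forall>y. slt r y x \<longrightarrow> (\<forall>\<^sub>F b in power_filter F k. P y (x # b))"
    using assms by (intro eventually_diagonal) (simp add: eventually_power_filter_Suc)
  then show ?thesis
    unfolding eventually_power_filter_Suc using eventually_Field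
  proof eventually_elim
    case (elim x)
    have "\<forall>\<^sub>F b in power_filter F k. \<forall>y\<in>underS r x. P y (x # b)"
      using elim by (intro eventually_Ball_less_power card_of_underS Card_order)
        (auto simp: slt_iff_underS)
    then show ?case
      by eventually_elim (auto simp: slt_iff_underS)
  qed
qed

text \<open>One diagonal intersection is taken per entry of \<open>e\<close>; the countably many
  lengths are then combined by completeness.\<close>

lemma eventually_diagonal_list:
  assumes "\<And>e. set e \<subseteq> Field r \<Longrightarrow> \<forall>\<^sub>F a in power_filter F (Suc k). P e a"
  shows "\<forall>\<^sub>F a in power_filter F (Suc k). \<forall>e. (\<forall>y\<in>set e. slt r y (hd a)) \<longrightarrow> P e a"
proof -
  have *: "\<forall>\<^sub>F a in power_filter F (Suc k). \<forall>e. length e = l \<longrightarrow> (\<forall>y\<in>set e. slt r y (hd a)) \<longrightarrow> P e a"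
    for l
    using assms
  proof (induction l arbitrary: P)
    case 0
    then show ?case by simp
  next
    case (Suc l)
    have "\<forall>\<^sub>F a in power_filter F (Suc k). \<forall>y. slt r y (hd a) \<longrightarrow>
        (\<forall>e. length e = l \<longrightarrow> (\<forall>y\<in>set e. slt r y (hd a)) \<longrightarrow> P (y # e) a)"
      by (intro eventually_diagonal_power Suc.IH Suc.prems) auto
    then show ?case
      by eventually_elim (auto simp: length_Suc_conv)
  qed
  have "|UNIV :: nat set| <o r"
    using card_of_nat natLeq_less ordIso_ordLess_trans by blast
  then have "\<forall>\<^sub>F a in power_filter F (Suc k). \<forall>l\<in>UNIV. \<forall>e. length e = l \<longrightarrow>
      (\<forall>y\<in>set e. slt r y (hd a)) \<longrightarrow> P e a"
    by (rule eventually_Ball_less_power) (rule *)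
  then show ?thesis
    by eventually_elim simp
qed

text \<open>
  Induction on the first coordinate: for almost every \<open>x\<close>, at most \<open>|M|\<close> many of the \<open>y < x\<close> have
  a positive section at \<open>x\<close>. Enumerating them gives \<open>|M|\<close> many regressive functions, and by
  saturation each takes at most \<open>|M|\<close> many values positively often.
\<close>

lemma card_almost_disjoint_power:
  assumes "\<Theta> \<subseteq> Field r"
    and "\<And>y. y \<in> \<Theta> \<Longrightarrow> \<exists>\<^sub>F x in power_filter F k. D y x"
    and "\<And>y z. y \<in> \<Theta> \<Longrightarrow> z \<in> \<Theta> \<Longrightarrow> y \<noteq> z \<Longrightarrow> \<forall>\<^sub>F x in power_filter F k. \<not> (D y x \<and> D z x)"
  shows "|\<Theta>| \<le>o |M|"
  using assms
proof (induction k arbitrary: \<Theta> D)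
  case 0
  then have "\<Theta> \<subseteq> {y}" if "y \<in> \<Theta>" for y
    using that by auto
  then have "finite \<Theta>"
    by (cases "\<Theta> = {}") (blast intro: finite_subset[of _ "{_}"])+
  then show ?case
    using infinite_M by (intro ordLess_imp_ordLeq finite_ordLess_infinite)
      (simp_all add: card_of_well_order_on Field_card_of)
next
  case (Suc k)
  show ?case
  proof (rule ccontr)
    assume "\<not> |\<Theta>| \<le>o |M|"
    define I where "I x = {y \<in> \<Theta>. slt r y x \<and> (\<exists>\<^sub>F b in power_filter F k. D y (x # b))}" for x
    have "\<forall>\<^sub>F x in F. \<forall>y. slt r y x \<longrightarrow> (\<forall>z. slt r z x \<longrightarrow> y \<in> \<Theta> \<longrightarrow> z \<in> \<Theta> \<longrightarrow> y \<noteq> z \<longrightarrow>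
        (\<forall>\<^sub>F b in power_filter F k. \<not> (D y (x # b) \<and> D z (x # b))))"
      by (intro eventually_diagonal)
        (use Suc.prems(3) in \<open>simp add: eventually_power_filter_Suc\<close>)
    then have "\<forall>\<^sub>F x in F. |I x| \<le>o |M|"
    proof eventually_elim
      case (elim x)
      show ?case
        by (rule Suc.IH[where D = "\<lambda>y b. D y (x # b)"])
          (use elim Suc.prems(1) in \<open>auto simp: I_def\<close>)
    qed
    then have "\<forall>\<^sub>F x in F. \<exists>e. I x \<subseteq> e ` M"
    proof eventually_elim
      case (elim x)
      show ?case
      proof (cases "I x = {}")
        case False
        then show ?thesis using elim by (metis card_of_ordLeq2 order_refl)
      qed auto
    qed
    then obtain e where e: "\<forall>\<^sub>F x in F. I x \<subseteq> e x ` M"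
      unfolding eventually_ex by blast
    \<comment> \<open>These are the values that the regressive function sending \<open>x\<close> to
      \<open>e x \<eta>\<close> takes positively often. A \<open>y\<close> outside all of them still
      has positive sections at positively many \<open>x\<close>, hence is such a value for a single
      \<open>\<eta>\<close>: a contradiction.\<close>
    define E where "E \<eta> = {y \<in> \<Theta>. \<exists>\<^sub>F x in F. y \<in> I x \<and> e x \<eta> = y}" for \<eta>
    have "|E \<eta>| \<le>o |M|" for \<eta>
      by (rule card_almost_disjoint[where D = "\<lambda>y x. y \<in> I x \<and> e x \<eta> = y"])
        (use Suc.prems(1) in \<open>auto simp: E_def\<close>)
    then have "|\<Union>\<eta>\<in>M. E \<eta>| \<le>o |M|"
      by (intro card_of_UNION_ordLeq_infinite infinite_M card_of_refl ordIso_imp_ordLeq) auto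
    with \<open>\<not> |\<Theta>| \<le>o |M|\<close> obtain y where y: "y \<in> \<Theta>" "y \<notin> (\<Union>\<eta>\<in>M. E \<eta>)"
      by (meson card_of_mono1 ordLeq_transitive subsetI)
    have "\<exists>\<^sub>F x in F. \<exists>\<^sub>F b in power_filter F k. D y (x # b)"
      using Suc.prems(2)[OF y(1)] by (simp add: frequently_power_filter_Suc)
    then have "\<exists>\<^sub>F x in F. (slt r y x \<and> I x \<subseteq> e x ` M) \<and> (\<exists>\<^sub>F b in power_filter F k. D y (x # b))"
      using y(1) Suc.prems(1) by (intro frequently_eventually_conj eventually_conj e eventually_slt) auto
    then have "\<exists>\<^sub>F x in F. \<exists>\<eta>\<in>M. y \<in> I x \<and> e x \<eta> = y"
      by (rule frequently_elim1) (use y(1) in \<open>auto simp: I_def\<close>)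
    then obtain \<eta> where "\<eta> \<in> M" "\<exists>\<^sub>F x in F. y \<in> I x \<and> e x \<eta> = y"
      by (rule frequently_Bex_less[OF M_less])
    with y show False
      by (auto simp: E_def)
  qed
qed

text \<open>Otherwise normality makes almost every section \<open>D x\<close> almost disjoint from
  all earlier ones. The positive ones among these form an almost disjoint family indexed by a
  positive set \<open>\<Theta>\<close>. Saturation bounds \<open>\<Theta>\<close> by
  \<open>M\<close>, so it would be null.\<close>

lemma frequently_meets:
  assumes "\<exists>\<^sub>F x in F. \<exists>\<^sub>F b in power_filter F k. D x b"
  obtains y where "\<exists>\<^sub>F x in F. \<exists>\<^sub>F b in power_filter F k. D x b \<and> D y b"
proof (rule ccontr)
  assume "\<not> thesis"
  then have "\<forall>\<^sub>F x in F. \<forall>\<^sub>F b in power_filter F k. \<not> (D x b \<and> D y b)" for y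
    using that by (auto simp: frequently_def)
  then have "\<forall>\<^sub>F x in F. \<forall>y. slt r y x \<longrightarrow> (\<forall>\<^sub>F b in power_filter F k. \<not> (D x b \<and> D y b))"
    by (intro eventually_diagonal)
  with eventually_Field
  have ev: "\<forall>\<^sub>F x in F. x \<in> Field r \<and>
      (\<forall>y. slt r y x \<longrightarrow> (\<forall>\<^sub>F b in power_filter F k. \<not> (D x b \<and> D y b)))"
    by (rule eventually_conj)
  define \<Theta> where "\<Theta> = {x. (\<exists>\<^sub>F b in power_filter F k. D x b) \<and> x \<in> Field r \<and>
      (\<forall>y. slt r y x \<longrightarrow> (\<forall>\<^sub>F b in power_filter F k. \<not> (D x b \<and> D y b)))}"
  have "\<exists>\<^sub>F x in F. x \<in> \<Theta>"
    using frequently_eventually_conj[OF assms ev] by (rule frequently_elim1) (simp add: \<Theta>_def)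
  have "|\<Theta>| \<le>o |M|"
  proof (rule card_almost_disjoint_power)
    fix y z assume yz: "y \<in> \<Theta>" "z \<in> \<Theta>" "y \<noteq> z"
    then have "slt r y z \<or> slt r z y"
      by (intro slt_linear[OF Well_order]) (auto simp: \<Theta>_def)
    then show "\<forall>\<^sub>F b in power_filter F k. \<not> (D y b \<and> D z b)"
      using yz by (auto simp: \<Theta>_def elim: eventually_mono)
  qed (auto simp: \<Theta>_def)
  then have "\<forall>\<^sub>F x in F. x \<notin> \<Theta>"
    by (intro eventually_notin ordLeq_ordLess_trans[OF _ M_less])
  with \<open>\<exists>\<^sub>F x in F. x \<in> \<Theta>\<close> show False
    by (simp add: frequently_def)
qed

end

subsection \<open>Supports of functions on tuples\<close>

definition depends_on :: "('a list \<Rightarrow> 'b) \<Rightarrow> nat set \<Rightarrow> 'a list set \<Rightarrow> bool" where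
  "depends_on f I Y \<longleftrightarrow> (\<exists>v. \<forall>a\<in>Y. f a = v (nths a I))"

lemma depends_on_subset: "depends_on f I Y \<Longrightarrow> Z \<subseteq> Y \<Longrightarrow> depends_on f I Z"
  unfolding depends_on_def by blast

lemma depends_onD:
  "depends_on f I Y \<Longrightarrow> a \<in> Y \<Longrightarrow> b \<in> Y \<Longrightarrow> nths a I = nths b I \<Longrightarrow> f a = f b"
  unfolding depends_on_def by auto

lemma nths_eqI:
  assumes "length a = length b" and "\<And>i. i < length a \<Longrightarrow> i \<in> I \<Longrightarrow> a ! i = b ! i"
  shows "nths a I = nths b I"
  using assms
proof (induction a b arbitrary: I rule: list_induct2)
  case (Cons x xs y ys)
  have "nths xs {j. Suc j \<in> I} = nths ys {j. Suc j \<in> I}"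
    using Cons.prems[of "Suc _"] by (intro Cons.IH) auto
  then show ?case
    using Cons.prems[of 0] by (simp add: nths_Cons)
qed simp

text \<open>The powers of two below \<open>i\<close> sum to less than \<open>2 ^ i\<close>.\<close>

lemma set_encode_insert_lower:
  assumes "finite I" and "i \<in> I"
  shows "set_encode ({..<i} \<union> {j \<in> I. i < j}) < set_encode I"
proof -
  have "set_encode ({..<i} \<union> {j \<in> I. i < j}) = set_encode {..<i} + set_encode {j \<in> I. i < j}"
    unfolding set_encode_def using assms(1) by (subst sum.union_disjoint) auto
  also have "set_encode {..<i} < 2 ^ i"
    unfolding set_encode_def by (induction i) (auto simp: lessThan_Suc)
  also have "2 ^ i + set_encode {j \<in> I. i < j} = set_encode (insert i {j \<in> I. i < j})"
    using assms(1) by (simp add: set_encode_insert)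
  also have "\<dots> \<le> set_encode I"
    unfolding set_encode_def using assms by (intro sum_mono2) auto
  finally show ?thesis by simp
qed

context saturated_filter
begin

text \<open>
  The weights \<open>2\<^sup>i\<close> summed by \<^const>\<open>set_encode\<close> make it profitable to trade a coordinate for
  any number of earlier ones.
\<close>

definition least_support :: "nat \<Rightarrow> ('k list \<Rightarrow> 'b) \<Rightarrow> 'k list set \<Rightarrow> nat set \<Rightarrow> bool" where
  "least_support n f Y I \<longleftrightarrow> I \<subseteq> {..<n} \<and> depends_on f I Y \<and>
     (\<forall>I' Z. I' \<subseteq> {..<n} \<longrightarrow> Z \<subseteq> Y \<longrightarrow> (\<exists>\<^sub>F a in power_filter F n. a \<in> Z) \<longrightarrow>
        depends_on f I' Z \<longrightarrow> set_encode I \<le> set_encode I')"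

lemma least_supportD:
  assumes "least_support n f Y I"
  shows "I \<subseteq> {..<n}" and "depends_on f I Y"
    and "I' \<subseteq> {..<n} \<Longrightarrow> Z \<subseteq> Y \<Longrightarrow> \<exists>\<^sub>F a in power_filter F n. a \<in> Z \<Longrightarrow>
      depends_on f I' Z \<Longrightarrow> set_encode I \<le> set_encode I'"
  using assms unfolding least_support_def by (blast, blast, simp)

lemma least_support_subset: "least_support n f Y I \<Longrightarrow> Z \<subseteq> Y \<Longrightarrow> least_support n f Z I"
  unfolding least_support_def by (blast intro: depends_on_subset)

text \<open>The code is minimised over all positive subsets of \<open>X\<close> at once, so no
  further shrinking of \<open>Y\<close> can lower it. The full set \<open>{..<n}\<close> starts the
  search.\<close>

lemma least_support_exists:
  assumes "\<exists>\<^sub>F a in power_filter F n. a \<in> X" and "\<And>a. a \<in> X \<Longrightarrow> length a = n"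
  obtains Y I where "Y \<subseteq> X" "\<exists>\<^sub>F a in power_filter F n. a \<in> Y" "least_support n f Y I"
proof -
  define P where "P I \<longleftrightarrow> I \<subseteq> {..<n} \<and>
    (\<exists>Y\<subseteq>X. (\<exists>\<^sub>F a in power_filter F n. a \<in> Y) \<and> depends_on f I Y)" for I
  have "depends_on f {..<n} X"
    unfolding depends_on_def using assms(2) by (intro exI[of _ f]) auto
  with assms(1) have "P {..<n}"
    unfolding P_def by blast
  then obtain I where I: "P I" "\<And>I'. P I' \<Longrightarrow> set_encode I \<le> set_encode I'"
    using ex_has_least_nat[of P "{..<n}" set_encode] by blast
  then obtain Y where Y: "Y \<subseteq> X" "\<exists>\<^sub>F a in power_filter F n. a \<in> Y" "depends_on f I Y"
    unfolding P_def by blast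
  have "least_support n f Y I"
    unfolding least_support_def
  proof (intro conjI allI impI)
    fix I' Z assume "I' \<subseteq> {..<n}" "Z \<subseteq> Y" "\<exists>\<^sub>F a in power_filter F n. a \<in> Z" "depends_on f I' Z"
    then have "P I'"
      using Y(1) unfolding P_def by blast
    then show "set_encode I \<le> set_encode I'"
      by (rule I(2))
  qed (use I(1) Y in \<open>auto simp: P_def\<close>)
  with Y that show ?thesis by blast
qed

text \<open>If tail functions agreed with \<open>f\<close> too often,
  \<open>frequently_meets\<close> would supply a value \<open>h c\<close> that can replace
  coordinate \<open>i\<close> without changing \<open>f\<close>. Then \<open>f\<close> would depend
  on the coordinates below \<open>i\<close> and those of \<open>I\<close> above \<open>i\<close>, a
  support of smaller code.\<close>

lemma least_support_avoids:
  assumes ls: "least_support (i + Suc k) f Y I" and i: "i \<in> I"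
  shows "\<forall>\<^sub>F c in power_filter F i. \<forall>u. \<forall>\<^sub>F x in power_filter F (Suc k).
    c @ x \<in> Y \<longrightarrow> f (c @ x) \<noteq> u (tl x)"
proof (rule ccontr)
  assume "\<not> ?thesis"
  then have fr: "\<exists>\<^sub>F c in power_filter F i. \<exists>u. \<exists>\<^sub>F x in F. \<exists>\<^sub>F d in power_filter F k.
      c @ x # d \<in> Y \<and> f (c @ x # d) = u d"
    by (simp add: not_eventually not_all not_imp frequently_power_filter_Suc)
  \<comment> \<open>The replacement value may depend on \<open>c\<close>, since the new support
    keeps every coordinate of \<open>c\<close>.\<close>
  define h where "h c = (SOME y. \<exists>\<^sub>F x in F. \<exists>\<^sub>F d in power_filter F k.
      c @ x # d \<in> Y \<and> c @ y # d \<in> Y \<and> f (c @ x # d) = f (c @ y # d))" for c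
  from fr have "\<exists>\<^sub>F c in power_filter F i. \<exists>y. \<exists>\<^sub>F x in F. \<exists>\<^sub>F d in power_filter F k.
      c @ x # d \<in> Y \<and> c @ y # d \<in> Y \<and> f (c @ x # d) = f (c @ y # d)"
  proof (rule frequently_elim1, elim exE)
    fix c u assume "\<exists>\<^sub>F x in F. \<exists>\<^sub>F d in power_filter F k. c @ x # d \<in> Y \<and> f (c @ x # d) = u d"
    then obtain y where "\<exists>\<^sub>F x in F. \<exists>\<^sub>F d in power_filter F k.
        (c @ x # d \<in> Y \<and> f (c @ x # d) = u d) \<and> (c @ y # d \<in> Y \<and> f (c @ y # d) = u d)"
      by (rule frequently_meets)
    then show "\<exists>y. \<exists>\<^sub>F x in F. \<exists>\<^sub>F d in power_filter F k.
        c @ x # d \<in> Y \<and> c @ y # d \<in> Y \<and> f (c @ x # d) = f (c @ y # d)"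
      by (intro exI[of _ y]) (auto elim!: frequently_elim1)
  qed
  then have h: "\<exists>\<^sub>F c in power_filter F i. \<exists>\<^sub>F x in F. \<exists>\<^sub>F d in power_filter F k.
      c @ x # d \<in> Y \<and> c @ h c # d \<in> Y \<and> f (c @ x # d) = f (c @ h c # d)"
    by (rule frequently_elim1) (unfold h_def, rule someI_ex)
  define Z where "Z = {c @ x # d | c x d. length c = i \<and>
      c @ x # d \<in> Y \<and> c @ h c # d \<in> Y \<and> f (c @ x # d) = f (c @ h c # d)}"
  have "\<exists>\<^sub>F c in power_filter F i. \<exists>\<^sub>F x in F. \<exists>\<^sub>F d in power_filter F k. c @ x # d \<in> Z"
    using frequently_eventually_conj[OF h eventually_length_power_filter]
    by (rule frequently_elim1) (auto simp: Z_def elim!: frequently_elim1)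
  then have "\<exists>\<^sub>F a in power_filter F (i + Suc k). a \<in> Z"
    unfolding frequently_power_filter_add frequently_power_filter_Suc .
  moreover have "depends_on f ({..<i} \<union> {j \<in> I. i < j}) Z"
  proof -
    obtain v where v: "\<And>a. a \<in> Y \<Longrightarrow> f a = v (nths a I)"
      using least_supportD(2)[OF ls] unfolding depends_on_def by blast
    \<comment> \<open>All coordinates below \<open>i\<close> are kept, so \<open>take i z\<close> is
      exactly \<open>c\<close>; this recovers \<open>h c\<close> and the list to which
      \<open>v\<close> applies.\<close>
    define v' where "v' z = v (nths (take i z) I @ h (take i z) # drop i z)" for z
    have "f a = v' (nths a ({..<i} \<union> {j \<in> I. i < j}))" if "a \<in> Z" for a
    proof -
      obtain c x d where a: "a = c @ x # d" "length c = i" "c @ h c # d \<in> Y"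
        "f a = f (c @ h c # d)"
        using \<open>a \<in> Z\<close> unfolding Z_def by blast
      have "nths c ({..<i} \<union> {j \<in> I. i < j}) = c"
        using a(2) by (simp add: nths_all)
      then have "nths a ({..<i} \<union> {j \<in> I. i < j}) = c @ nths d {j. Suc (j + i) \<in> I}"
        using a by (simp add: nths_append nths_Cons)
      moreover have "nths (c @ h c # d) I = nths c I @ h c # nths d {j. Suc (j + i) \<in> I}"
        using a i by (simp add: nths_append nths_Cons)
      ultimately show ?thesis
        using a v[OF a(3)] by (simp add: v'_def)
    qed
    then show ?thesis
      unfolding depends_on_def by blast
  qed
  moreover have "Z \<subseteq> Y"
    unfolding Z_def by blast
  moreover have "{..<i} \<union> {j \<in> I. i < j} \<subseteq> {..<i + Suc k}"
    using least_supportD(1)[OF ls] by auto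
  ultimately have "set_encode I \<le> set_encode ({..<i} \<union> {j \<in> I. i < j})"
    using least_supportD(3)[OF ls] by blast
  moreover have "finite I"
    using least_supportD(1)[OF ls] by (rule finite_subset) simp
  ultimately show False
    using set_encode_insert_lower[of I i] i by simp
qed

text \<open>Since \<open>i < m\<close>, \<open>drop m a\<close> lies in the tail after coordinate
  \<open>i\<close>. For fixed \<open>e\<close> the right-hand side is thus a tail function, excluded
  by \<open>least_support_avoids\<close>; a diagonal intersection covers all \<open>e\<close> below
  \<open>a ! i\<close>.\<close>

lemma least_support_avoids_lower:
  assumes ls: "least_support n f Y I" and i: "i \<in> I" and m: "i < m"
  shows "\<forall>\<^sub>F a in power_filter F n. a \<in> Y \<longrightarrow>
    (\<forall>e. (\<forall>y\<in>set e. slt r y (a ! i)) \<longrightarrow> f a \<noteq> w (e @ nths (drop m a) I'))"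
proof -
  have "i < n"
    using least_supportD(1)[OF ls] i by auto
  then obtain k where n: "n = i + Suc k"
    using less_iff_Suc_add by auto
  show ?thesis
    unfolding n eventually_power_filter_add
    using least_support_avoids[OF ls[unfolded n] i] eventually_length_power_filter[where i = i]
  proof eventually_elim
    case (elim c)
    have "\<forall>\<^sub>F x in power_filter F (Suc k). \<forall>e. (\<forall>y\<in>set e. slt r y (hd x)) \<longrightarrow>
        c @ x \<in> Y \<longrightarrow> f (c @ x) \<noteq> w (e @ nths (drop (m - Suc i) (tl x)) I')"
    proof (rule eventually_diagonal_list)
      fix e
      show "\<forall>\<^sub>F x in power_filter F (Suc k). c @ x \<in> Y \<longrightarrow>
          f (c @ x) \<noteq> w (e @ nths (drop (m - Suc i) (tl x)) I')"
        by (rule spec[OF elim(1), of "\<lambda>d. w (e @ nths (drop (m - Suc i) d) I')"])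
    qed
    then show ?case
      using eventually_length_power_filter[where i = "Suc k"]
    proof eventually_elim
      case (elim x)
      \<comment> \<open>Dropping \<open>m\<close> entries removes \<open>c\<close>, the head of
        \<open>x\<close>, and \<open>m - Suc i\<close> entries of its tail.\<close>
      have "(c @ x) ! i = hd x" "drop m (c @ x) = drop (m - Suc i) (tl x)"
        using elim(2) \<open>length c = i\<close> m by (auto simp: length_Suc_conv Suc_diff_Suc drop_Cons')
      then show ?case
        using elim(1) by auto
    qed
  qed
qed

text \<open>Up to position \<open>max i j\<close> the entries of \<open>b\<close> in
  \<open>I'\<close> lie below \<open>a ! i\<close>; beyond it they coincide with those of
  \<open>a\<close>. So \<open>g b\<close> is \<open>w\<close> applied to small parameters followed
  by a tail of \<open>a\<close>, which cannot equal \<open>f a\<close>.\<close>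

lemma support_overlap:
  assumes lf: "least_support n f Y I" and lg: "least_support n g Y I'"
    and len: "\<And>a. a \<in> Y \<Longrightarrow> length a = n"
    and sorted: "\<And>a. a \<in> Y \<Longrightarrow> sorted_wrt (slt r) a"
  shows "\<forall>\<^sub>F a in power_filter F n. a \<in> Y \<longrightarrow>
    (\<forall>b\<in>Y. \<forall>i\<in>I. \<forall>j\<in>I'. slt r (b ! j) (a ! i) \<longrightarrow> a ! i \<noteq> b ! i \<longrightarrow>
      (\<forall>l\<in>I. i < l \<longrightarrow> a ! l = b ! l) \<longrightarrow> (\<forall>l\<in>I'. j < l \<longrightarrow> a ! l = b ! l) \<longrightarrow> f a \<noteq> g b)"
proof -
  obtain w where w: "\<forall>b\<in>Y. g b = w (nths b I')"
    using least_supportD(2)[OF lg] unfolding depends_on_def by (elim exE)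
  have fin: "finite (I \<times> I')"
    using least_supportD(1)[OF lf] least_supportD(1)[OF lg]
    by (auto intro: finite_subset[of _ "{..<n}"])
  have "\<forall>\<^sub>F a in power_filter F n. \<forall>(i, j) \<in> I \<times> I'. a \<in> Y \<longrightarrow>
    (\<forall>e. (\<forall>y\<in>set e. slt r y (a ! i)) \<longrightarrow>
      f a \<noteq> w (e @ nths (drop (Suc (max i j)) a) {l. l + Suc (max i j) \<in> I'}))"
    unfolding case_prod_beta
    by (intro eventually_ball_finite fin ballI least_support_avoids_lower[OF lf]) auto
  then show ?thesis
  proof eventually_elim
    case (elim a)
    show ?case
    proof (intro impI ballI)
      fix b i j
      assume a: "a \<in> Y" and b: "b \<in> Y" and ij: "i \<in> I" "j \<in> I'" and less: "slt r (b ! j) (a ! i)"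
        and neq: "a ! i \<noteq> b ! i"
        and I: "\<forall>l\<in>I. i < l \<longrightarrow> a ! l = b ! l" and I': "\<forall>l\<in>I'. j < l \<longrightarrow> a ! l = b ! l"
      let ?m = "Suc (max i j)"
      have [simp]: "length a = n" "length b = n"
        using a b len by auto
      have ijn: "i < n" "j < n"
        using ij least_supportD(1)[OF lf] least_supportD(1)[OF lg] by auto
      have "slt r (b ! l) (a ! i)" if l: "l \<in> I'" "l < ?m" for l
      proof -
        consider "l < j" | "l = j" | "j < l" by linarith
        then show ?thesis
        proof cases
          case 1
          then have "slt r (b ! l) (b ! j)"
            using sorted[OF b] ijn by (simp add: sorted_wrt_iff_nth_less)
          then show ?thesis
            using less slt_trans[OF Well_order] by blast
        next
          \<comment> \<open>Here \<open>l \<le> i\<close>, because \<open>l\<close> exceeds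
            \<open>j\<close> but not \<open>max i j\<close>; equality is excluded by
            \<open>a ! i \<noteq> b ! i\<close>.\<close>
          case 3
          then have "b ! l = a ! l"
            using l I' by auto
          moreover from this have "l < i"
            using 3 l neq by (cases "l = i") auto
          ultimately show ?thesis
            using sorted[OF a] ijn by (simp add: sorted_wrt_iff_nth_less)
        qed (use less in simp)
      qed
      then have "\<forall>y \<in> set (nths (take ?m b) I'). slt r y (a ! i)"
        using ijn by (auto simp: set_nths)
      moreover have "nths (drop ?m a) {l. l + ?m \<in> I'} = nths (drop ?m b) {l. l + ?m \<in> I'}"
        using I' ijn by (intro nths_eqI) (auto simp: add.commute)
      moreover have "nths b I' = nths (take ?m b) I' @ nths (drop ?m b) {l. l + ?m \<in> I'}"
        using nths_append[of "take ?m b" "drop ?m b" I'] ijn by simp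
      moreover have "\<forall>e. (\<forall>y\<in>set e. slt r y (a ! i)) \<longrightarrow>
          f a \<noteq> w (e @ nths (drop ?m a) {l. l + ?m \<in> I'})"
        using bspec[OF elim, of "(i, j)"] ij a by simp
      ultimately show "f a \<noteq> g b"
        using bspec[OF w b] by metis
    qed
  qed
qed

end

subsection \<open>Separating two functions\<close>

definition index_compatible :: "'a list \<Rightarrow> 'a list \<Rightarrow> bool" where
  "index_compatible a b \<longleftrightarrow> (\<forall>i<length a. \<forall>j<length b. a ! i = b ! j \<longrightarrow> i = j)"

lemma sorted_wrt_slt_unique:
  assumes "Well_order r" and "sorted_wrt (slt r) xs" and "sorted_wrt (slt r) ys" and "set xs = set ys"
  shows "xs = ys"
  using assms(2-)
proof (induction xs arbitrary: ys)
  case (Cons x xs)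
  then obtain y ys' where ys: "ys = y # ys'"
    by (cases ys) auto
  have nxy: "x \<notin> set xs" "y \<notin> set ys'"
    using Cons.prems by (auto simp: ys slt_def)
  have "x = y"
  proof (rule ccontr)
    assume "x \<noteq> y"
    then have "slt r x y" "slt r y x"
      using Cons.prems by (auto simp: ys)
    then show False
      using slt_asym[OF assms(1)] by blast
  qed
  moreover have "xs = ys'"
    using Cons.prems nxy \<open>x = y\<close> by (intro Cons.IH) (auto simp: ys)
  ultimately show ?case
    by (simp add: ys)
qed simp

lemma distinct_if_sorted_wrt_slt: "sorted_wrt (slt r) b \<Longrightarrow> distinct b"
  by (induction b) (auto simp: slt_def)

text \<open>Increasing enumerations are unique, so the order isomorphism carries \<open>a\<close> to
  \<open>b\<close> entry by entry. A common element is fixed, hence keeps its position.\<close>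

lemma tuple_sim_imp_index_compatible:
  assumes "Well_order r" and a: "a \<in> tuples r n" and b: "b \<in> tuples r n" and "tuple_sim r a b"
  shows "index_compatible a b"
proof -
  obtain f where f: "bij_betw f (set a) (set b)" "monotone_on (set a) (slt r) (slt r) f"
    "\<forall>x \<in> set a \<inter> set b. f x = x"
    using assms(4) unfolding tuple_sim_def by blast
  have "map f a = b"
  proof (rule sorted_wrt_slt_unique[OF assms(1)])
    show "sorted_wrt (slt r) (map f a)"
      using a f(2) unfolding sorted_wrt_map tuples_def
      by (auto intro: sorted_wrt_mono_rel[rotated] dest: monotone_onD)
    show "set (map f a) = set b"
      using f(1) by (simp add: bij_betw_def)
  qed (use b in \<open>simp add: tuples_def\<close>)
  have "distinct b"
    using b by (auto simp: tuples_def intro: distinct_if_sorted_wrt_slt)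
  show ?thesis
    unfolding index_compatible_def
  proof (intro allI impI)
    fix i j assume ij: "i < length a" "j < length b" "a ! i = b ! j"
    have "a ! i \<in> set a" "b ! j \<in> set b"
      using ij(1,2) by simp_all
    then have "f (a ! i) = a ! i"
      using f(3) ij(3) by simp
    then have "b ! i = b ! j"
      using ij nth_map[OF ij(1), of f] unfolding \<open>map f a = b\<close> by simp
    moreover have "i < length b"
      using ij(1) unfolding \<open>map f a = b\<close>[symmetric] by simp
    ultimately show "i = j"
      using \<open>distinct b\<close> ij(2) by (simp add: nth_eq_iff_index_eq)
  qed
qed

lemma finite_last_exception:
  fixes I :: "nat set"
  assumes "finite I" and "\<not> (\<forall>l\<in>I. P l)"
  obtains i where "i \<in> I" "\<not> P i" "\<forall>l\<in>I. i < l \<longrightarrow> P l"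
proof -
  let ?D = "{l \<in> I. \<not> P l}"
  have "finite ?D" "?D \<noteq> {}"
    using assms by auto
  then have "Max ?D \<in> ?D" "\<forall>l\<in>?D. l \<le> Max ?D"
    by (rule Max_in, simp)
  then show ?thesis
    using that[of "Max ?D"] leD by blast
qed

context saturated_filter
begin

lemma separate:
  assumes freq: "\<exists>\<^sub>F a in power_filter F n. a \<in> X" and X: "X \<subseteq> tuples r n"
    and neq: "\<And>a. a \<in> X \<Longrightarrow> f a \<noteq> g a"
  obtains Y where "Y \<subseteq> X" "\<exists>\<^sub>F a in power_filter F n. a \<in> Y"
    "\<forall>a\<in>Y. \<forall>b\<in>Y. index_compatible a b \<longrightarrow> f a \<noteq> g b"
proof -
  have len: "length a = n" if "a \<in> X" for a
    using that X by (auto simp: tuples_def)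
  obtain Y\<^sub>1 I where 1: "Y\<^sub>1 \<subseteq> X" "\<exists>\<^sub>F a in power_filter F n. a \<in> Y\<^sub>1" "least_support n f Y\<^sub>1 I"
    by (rule least_support_exists[OF freq len])
  have "length a = n" if "a \<in> Y\<^sub>1" for a
    using that len 1(1) by blast
  from least_support_exists[OF 1(2) this]
  obtain Y\<^sub>2 I' where 2: "Y\<^sub>2 \<subseteq> Y\<^sub>1" "\<exists>\<^sub>F a in power_filter F n. a \<in> Y\<^sub>2" "least_support n g Y\<^sub>2 I'"
    .
  have lf: "least_support n f Y\<^sub>2 I"
    by (rule least_support_subset[OF 1(3) 2(1)])
  have Y\<^sub>2: "length a = n" "sorted_wrt (slt r) a" "set a \<subseteq> Field r" if "a \<in> Y\<^sub>2" for a
    using that 1(1) 2(1) X by (auto simp: tuples_def)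
  note ev = support_overlap[OF lf 2(3) Y\<^sub>2(1,2)] support_overlap[OF 2(3) lf Y\<^sub>2(1,2)]
  \<comment> \<open>The exceptional points of \<open>support_overlap\<close> are removed for both
    roles of \<open>f\<close> and \<open>g\<close>, since either of the two last differing entries
    may be the larger one.\<close>
  define Y where "Y = {a \<in> Y\<^sub>2.
    (\<forall>b\<in>Y\<^sub>2. \<forall>i\<in>I. \<forall>j\<in>I'. slt r (b ! j) (a ! i) \<longrightarrow> a ! i \<noteq> b ! i \<longrightarrow>
      (\<forall>l\<in>I. i < l \<longrightarrow> a ! l = b ! l) \<longrightarrow> (\<forall>l\<in>I'. j < l \<longrightarrow> a ! l = b ! l) \<longrightarrow> f a \<noteq> g b) \<and>
    (\<forall>b\<in>Y\<^sub>2. \<forall>i\<in>I'. \<forall>j\<in>I. slt r (b ! j) (a ! i) \<longrightarrow> a ! i \<noteq> b ! i \<longrightarrow>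
      (\<forall>l\<in>I'. i < l \<longrightarrow> a ! l = b ! l) \<longrightarrow> (\<forall>l\<in>I. j < l \<longrightarrow> a ! l = b ! l) \<longrightarrow> g a \<noteq> f b)}"
  have "\<exists>\<^sub>F a in power_filter F n. a \<in> Y"
    using frequently_eventually_conj[OF 2(2) eventually_conj[OF ev]]
    by (rule frequently_elim1) (auto simp: Y_def)
  moreover have "f a \<noteq> g b" if a: "a \<in> Y" and b: "b \<in> Y" and ab: "index_compatible a b" for a b
  proof
    assume eq: "f a = g b"
    have aY: "a \<in> Y\<^sub>2" and bY: "b \<in> Y\<^sub>2"
      using a b by (auto simp: Y_def)
    have aX: "a \<in> X" and bX: "b \<in> X"
      using aY bY 1 2 by auto
    have nths: "nths a L = nths b L" if "\<forall>l\<in>L. a ! l = b ! l" for L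
      using that Y\<^sub>2[OF aY] Y\<^sub>2[OF bY] by (intro nths_eqI) auto
    have sub: "I \<subseteq> {..<n}" "I' \<subseteq> {..<n}"
      using least_supportD(1)[OF lf] least_supportD(1)[OF 2(3)] .
    then have fin: "finite I" "finite I'"
      by (auto intro: finite_subset[of _ "{..<n}"])
    have "\<not> (\<forall>l\<in>I. a ! l = b ! l)"
    proof
      assume "\<forall>l\<in>I. a ! l = b ! l"
      then have "f a = f b"
        using depends_onD[OF least_supportD(2)[OF lf] aY bY nths] by simp
      with eq neq[OF bX] show False by simp
    qed
    then obtain i where i: "i \<in> I" "a ! i \<noteq> b ! i" "\<forall>l\<in>I. i < l \<longrightarrow> a ! l = b ! l"
      by (rule finite_last_exception[OF fin(1)])
    have "\<not> (\<forall>l\<in>I'. a ! l = b ! l)"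
    proof
      assume "\<forall>l\<in>I'. a ! l = b ! l"
      then have "g a = g b"
        using depends_onD[OF least_supportD(2)[OF 2(3)] aY bY nths] by simp
      with eq neq[OF aX] show False by simp
    qed
    then obtain j where j: "j \<in> I'" "a ! j \<noteq> b ! j" "\<forall>l\<in>I'. j < l \<longrightarrow> a ! l = b ! l"
      by (rule finite_last_exception[OF fin(2)])
    have ijn: "i < n" "j < n"
      using i(1) j(1) sub by auto
    \<comment> \<open>Equality would force \<open>i = j\<close> by compatibility, but
      \<open>a\<close> and \<open>b\<close> differ at \<open>i\<close>.\<close>
    then have "a ! i \<noteq> b ! j"
      using ab i(2) Y\<^sub>2(1)[OF aY] Y\<^sub>2(1)[OF bY] unfolding index_compatible_def by metis
    moreover have "a ! i \<in> Field r" "b ! j \<in> Field r"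
      using ijn nth_mem[of i a] nth_mem[of j b] Y\<^sub>2(1)[OF aY] Y\<^sub>2(1)[OF bY]
      by (auto intro: subsetD[OF Y\<^sub>2(3)[OF aY]] subsetD[OF Y\<^sub>2(3)[OF bY]])
    ultimately consider "slt r (b ! j) (a ! i)" | "slt r (a ! i) (b ! j)"
      using slt_linear[OF Well_order] by blast
    then show False
    proof cases
      case 1
      then have "f a \<noteq> g b"
        using a bY i j unfolding Y_def by simp
      with eq show False by simp
    next
      \<comment> \<open>The second clause of \<open>Y\<close> applies with \<open>a\<close> and
        \<open>b\<close> exchanged.\<close>
      case 2
      then have "g b \<noteq> f a"
        using b aY i j unfolding Y_def by (simp add: eq_commute)
      with eq show False by simp
    qed
  qed
  moreover have "Y \<subseteq> X"
    using 1(1) 2(1) unfolding Y_def by blast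
  ultimately show ?thesis
    using that[of Y] by simp
qed

lemma separate_finite:
  assumes "finite Q" and "\<exists>\<^sub>F a in power_filter F n. a \<in> X" and "X \<subseteq> tuples r n"
    and "\<And>f g a. (f, g) \<in> Q \<Longrightarrow> a \<in> X \<Longrightarrow> f a \<noteq> g a"
  shows "\<exists>Y\<subseteq>X. (\<exists>\<^sub>F a in power_filter F n. a \<in> Y) \<and>
    (\<forall>(f, g)\<in>Q. \<forall>a\<in>Y. \<forall>b\<in>Y. index_compatible a b \<longrightarrow> f a \<noteq> g b)"
  using assms
proof (induction Q)
  case (insert q Q)
  obtain f g where q: "q = (f, g)" by (cases q)
  obtain Y where Y: "Y \<subseteq> X" "\<exists>\<^sub>F a in power_filter F n. a \<in> Y"
    "\<forall>(f, g)\<in>Q. \<forall>a\<in>Y. \<forall>b\<in>Y. index_compatible a b \<longrightarrow> f a \<noteq> g b"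
    using insert.IH[OF insert.prems(1,2)] insert.prems(3) by auto
  have "f a \<noteq> g a" if "a \<in> Y" for a
    using insert.prems(3)[of f g a] that Y(1) q by auto
  from separate[OF Y(2) order_trans[OF Y(1) insert.prems(2)] this]
  obtain Z where Z: "Z \<subseteq> Y" "\<exists>\<^sub>F a in power_filter F n. a \<in> Z"
    "\<forall>a\<in>Z. \<forall>b\<in>Z. index_compatible a b \<longrightarrow> f a \<noteq> g b"
    .
  have "f' a \<noteq> g' b" if fg: "(f', g') \<in> insert q Q" and ab: "a \<in> Z" "b \<in> Z" "index_compatible a b"
    for f' g' a b
  proof (cases "(f', g') = q")
    case True
    then show ?thesis
      using Z(3) ab by (simp add: q)
  next
    case False
    then have "(f', g') \<in> Q"
      using fg by simp
    from bspec[OF Y(3) this] show ?thesis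
      using ab Z(1) by (simp add: subset_iff)
  qed
  moreover have "Z \<subseteq> X"
    using Z(1) Y(1) by (rule order_trans)
  ultimately show ?case
    using Z(2) by (intro exI[of _ Z]) (simp add: case_prod_beta)
qed auto

text \<open>Value lists form a countable type, so one list \<open>vs\<close> serves a positive set.
  Separating the enumeration functions at distinct indices forces a common point to have the same
  index in both domains, hence the same value.\<close>

lemma finite_maps_agree:
  fixes p :: "'k list \<Rightarrow> 'x \<rightharpoonup> 'y::countable"
  assumes freq: "\<exists>\<^sub>F a in power_filter F n. a \<in> X" and X: "X \<subseteq> tuples r n"
    and fin: "\<And>a. a \<in> X \<Longrightarrow> finite (dom (p a))"
  obtains Y where "Y \<subseteq> X" "\<exists>\<^sub>F a in power_filter F n. a \<in> Y"
    "\<forall>a\<in>Y. \<forall>b\<in>Y. index_compatible a b \<longrightarrow> (\<forall>x \<in> dom (p a) \<inter> dom (p b). p a x = p b x)"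
proof -
  have "\<forall>a\<in>X. \<exists>xs. set xs = dom (p a) \<and> distinct xs"
    using fin finite_distinct_list by blast
  then obtain e where e: "\<And>a. a \<in> X \<Longrightarrow> set (e a) = dom (p a)" "\<And>a. a \<in> X \<Longrightarrow> distinct (e a)"
    by metis
  have "\<exists>\<^sub>F a in power_filter F n. \<exists>vs. a \<in> X \<and> map (the \<circ> p a) (e a) = vs"
    using freq by simp
  then obtain vs where vs: "\<exists>\<^sub>F a in power_filter F n. a \<in> X \<and> map (the \<circ> p a) (e a) = vs"
    by (rule frequently_ex_countable_power)
  define X' where "X' = {a \<in> X. map (the \<circ> p a) (e a) = vs}"
  have X': "a \<in> X" "map (the \<circ> p a) (e a) = vs" "length (e a) = length vs" if "a \<in> X'" for a
    using that unfolding X'_def by auto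
  \<comment> \<open>Off the diagonal the two functions of a pair differ at every \<open>a\<close>,
    because \<open>e a\<close> has no repetitions.\<close>
  define Q where "Q = (\<lambda>(i, j). (\<lambda>a. e a ! i, \<lambda>a. e a ! j)) `
    ({..<length vs} \<times> {..<length vs} - Id)"
  have "finite Q"
    unfolding Q_def by simp
  moreover have "\<exists>\<^sub>F a in power_filter F n. a \<in> X'"
    using vs by (simp add: X'_def)
  moreover have "X' \<subseteq> tuples r n"
    using X X'(1) by auto
  moreover have "f a \<noteq> g a" if "(f, g) \<in> Q" "a \<in> X'" for f g a
    using that e(2)[OF X'(1)] X'(3) by (auto simp: Q_def nth_eq_iff_index_eq)
  ultimately have "\<exists>Y\<subseteq>X'. (\<exists>\<^sub>F a in power_filter F n. a \<in> Y) \<and>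
    (\<forall>(f, g)\<in>Q. \<forall>a\<in>Y. \<forall>b\<in>Y. index_compatible a b \<longrightarrow> f a \<noteq> g b)"
    by (rule separate_finite)
  then obtain Y where Y: "Y \<subseteq> X'" "\<exists>\<^sub>F a in power_filter F n. a \<in> Y"
    "\<forall>(f, g)\<in>Q. \<forall>a\<in>Y. \<forall>b\<in>Y. index_compatible a b \<longrightarrow> f a \<noteq> g b"
    by (elim exE conjE) (rule that)
  have "p a x = p b x" if ab: "a \<in> Y" "b \<in> Y" "index_compatible a b"
    and x: "x \<in> dom (p a)" "x \<in> dom (p b)" for a b x
  proof -
    have aX: "a \<in> X'" and bX: "b \<in> X'"
      using ab Y by auto
    obtain i j where ij: "i < length vs" "j < length vs" "x = e a ! i" "x = e b ! j"
      using x e(1)[OF X'(1)[OF aX]] e(1)[OF X'(1)[OF bX]] X'(3)[OF aX] X'(3)[OF bX]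
      by (metis in_set_conv_nth)
    have "i = j"
    proof (rule ccontr)
      assume "i \<noteq> j"
      then have "(\<lambda>a. e a ! i, \<lambda>a. e a ! j) \<in> Q"
        using ij unfolding Q_def by force
      then have "e a ! i \<noteq> e b ! j"
        using Y(3) ab by fast
      with ij show False by simp
    qed
    then have "the (p a x) = vs ! i" "the (p b x) = vs ! i"
      using ij X'(2)[OF aX] X'(2)[OF bX] X'(3)[OF aX] X'(3)[OF bX]
      by (metis comp_apply nth_map)+
    with x show ?thesis
      by auto
  qed
  moreover have "Y \<subseteq> X"
    using Y(1) X'(1) by blast
  ultimately show ?thesis
    using that[of Y] Y(2) by simp
qed

end

subsection \<open>The dual filter of an ideal\<close>

definition dual_as_filter :: "'a set \<Rightarrow> 'a set set \<Rightarrow> 'a filter" where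
  "dual_as_filter K J = Abs_filter (\<lambda>P. {x \<in> K. \<not> P x} \<in> J)"

lemma eventually_dual_as_filter:
  assumes "ideal_on K J"
  shows "eventually P (dual_as_filter K J) \<longleftrightarrow> {x \<in> K. \<not> P x} \<in> J"
  unfolding dual_as_filter_def
proof (rule eventually_Abs_filter, rule is_filter.intro)
  have down: "X \<in> J" if "Y \<in> J" "X \<subseteq> Y" for X Y
    using assms that unfolding ideal_on_def by blast
  fix P Q :: "'a \<Rightarrow> bool"
  assume P: "{x \<in> K. \<not> P x} \<in> J"
  show "{x \<in> K. \<not> (P x \<and> Q x)} \<in> J" if "{x \<in> K. \<not> Q x} \<in> J"
  proof (rule down)
    show "{x \<in> K. \<not> P x} \<union> {x \<in> K. \<not> Q x} \<in> J"
      using assms P that unfolding ideal_on_def by blast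
  qed auto
  show "{x \<in> K. \<not> Q x} \<in> J" if "\<forall>x. P x \<longrightarrow> Q x"
    by (rule down[OF P]) (use that in auto)
qed (use assms in \<open>simp add: ideal_on_def\<close>)

lemma frequently_dual_as_filter:
  assumes "ideal_on K J"
  shows "frequently P (dual_as_filter K J) \<longleftrightarrow> {x \<in> K. P x} \<notin> J"
  by (simp add: frequently_def eventually_dual_as_filter[OF assms])

text \<open>Induction peels off the first coordinate. Sections of a set of increasing tuples consist
  of increasing tuples, so restricting them to \<open>tuples r (Suc n)\<close> loses
  nothing.\<close>

lemma fubini_power_iff:
  assumes "ideal_on (Field r) J" and "X \<subseteq> tuples r n"
  shows "X \<in> fubini_power r J n \<longleftrightarrow>
    (\<forall>\<^sub>F a in power_filter (dual_as_filter (Field r) J) n. a \<notin> X)"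
  using assms
proof (induction r J n arbitrary: X rule: fubini_power.induct)
  case (1 r J)
  then show ?case by (auto simp: tuples_def)
next
  case (2 r J)
  then show ?case
    by (simp add: eventually_power_filter_Suc eventually_dual_as_filter)
next
  case (3 r J n)
  let ?F = "dual_as_filter (Field r) J"
  have "{b \<in> tuples r (Suc n). \<alpha> # b \<in> X} \<in> fubini_power r J (Suc n) \<longleftrightarrow>
      (\<forall>\<^sub>F b in power_filter ?F (Suc n). \<alpha> # b \<notin> X)" for \<alpha>
  proof -
    have "b \<in> tuples r (Suc n)" if "\<alpha> # b \<in> X" for b
      using subsetD[OF "3.prems"(2) that] by (simp add: tuples_def)
    then show ?thesis
      using "3.IH"[OF "3.prems"(1), of "{b \<in> tuples r (Suc n). \<alpha> # b \<in> X}"]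
      by (auto elim: eventually_mono)
  qed
  moreover have "Field r - {\<alpha> \<in> Field r. P \<alpha>} = {\<alpha> \<in> Field r. \<not> P \<alpha>}" for P
    by auto
  ultimately show ?case
    using 3 by (simp add: dual_filter_def eventually_power_filter_Suc[of _ _ "Suc n"]
        eventually_dual_as_filter del: fubini_power.simps(2))
qed

lemma positive_fubini_power_iff:
  assumes "ideal_on (Field r) J" and "X \<subseteq> tuples r n"
  shows "X \<in> positive_sets (tuples r n) (fubini_power r J n) \<longleftrightarrow>
    (\<exists>\<^sub>F a in power_filter (dual_as_filter (Field r) J) n. a \<in> X)"
  using fubini_power_iff[OF assms] assms(2) by (simp add: positive_sets_def frequently_def)

text \<open>The constant sequence with value \<open>K\<close> consists of positive sets, so
  saturation must produce two indices.\<close>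

lemma saturated_length_two:
  assumes "saturated s K J" and "ideal_on K J"
  obtains i j where "i \<in> Field s" "j \<in> Field s" "i \<noteq> j"
proof -
  have "\<exists>i j. slt s i j"
    using assms(1)[unfolded saturated_def, rule_format, of "\<lambda>_. K"] assms(2)
    by (auto simp: ideal_on_def positive_sets_def)
  then show ?thesis
    using that slt_Field unfolding slt_def by metis
qed

lemma eventually_diagonal_dual:
  assumes "ideal_on (Field r) J" and "normal_ideal r J"
    and "\<And>y. y \<in> Field r \<Longrightarrow> \<forall>\<^sub>F x in dual_as_filter (Field r) J. P y x"
  shows "\<forall>\<^sub>F x in dual_as_filter (Field r) J. \<forall>y. slt r y x \<longrightarrow> P y x"
proof -
  have "diagonal_union r (\<lambda>y. {x \<in> Field r. \<not> P y x}) \<in> J"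
    using assms unfolding normal_ideal_def by (simp add: eventually_dual_as_filter)
  moreover have "diagonal_union r (\<lambda>y. {x \<in> Field r. \<not> P y x}) =
      {x \<in> Field r. \<not> (\<forall>y. slt r y x \<longrightarrow> P y x)}"
    unfolding diagonal_union_def by auto
  ultimately show ?thesis
    by (simp only: eventually_dual_as_filter[OF assms(1)])
qed

text \<open>Otherwise \<open>Field s\<close> injects into \<open>\<Theta>\<close>, and saturation
  finds two members with positive intersection.\<close>

lemma card_almost_disjoint_ideal:
  assumes "ideal_on K J" and "saturated s K J"
    and "\<And>y. y \<in> \<Theta> \<Longrightarrow> \<exists>\<^sub>F x in dual_as_filter K J. D y x"
    and "\<And>y z. y \<in> \<Theta> \<Longrightarrow> z \<in> \<Theta> \<Longrightarrow> y \<noteq> z \<Longrightarrow> \<forall>\<^sub>F x in dual_as_filter K J. \<not> (D y x \<and> D z x)"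
  shows "|\<Theta>| \<le>o |Field s|"
proof (rule ccontr)
  assume "\<not> |\<Theta>| \<le>o |Field s|"
  moreover have "|\<Theta>| \<le>o |Field s| \<or> |Field s| \<le>o |\<Theta>|"
    by (rule ordLeq_total) (rule card_of_Well_order)+
  ultimately have "|Field s| \<le>o |\<Theta>|"
    by simp
  then obtain h where h: "inj_on h (Field s)" "h ` Field s \<subseteq> \<Theta>"
    unfolding card_of_ordLeq[symmetric] by (elim exE conjE) (rule that)
  have "\<forall>i\<in>Field s. {x \<in> K. D (h i) x} \<in> positive_sets K J"
    using h(2) assms(3) by (auto simp: positive_sets_def frequently_dual_as_filter[OF assms(1)])
  then have "\<exists>i j. slt s i j \<and> {x \<in> K. D (h i) x} \<inter> {x \<in> K. D (h j) x} \<in> positive_sets K J"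
    using spec[OF assms(2)[unfolded saturated_def], of "\<lambda>i. {x \<in> K. D (h i) x}"] by (rule mp[rotated])
  then obtain i j where ij: "slt s i j" "{x \<in> K. D (h i) x} \<inter> {x \<in> K. D (h j) x} \<in> positive_sets K J"
    by (elim exE conjE) (rule that)
  have "i \<in> Field s" "j \<in> Field s" "i \<noteq> j"
    using slt_Field[OF ij(1)] ij(1) by (simp_all add: slt_def)
  then have "\<forall>\<^sub>F x in dual_as_filter K J. \<not> (D (h i) x \<and> D (h j) x)"
    using h by (intro assms(4)) (auto simp: inj_on_eq_iff)
  then have "{x \<in> K. D (h i) x \<and> D (h j) x} \<in> J"
    by (simp add: eventually_dual_as_filter[OF assms(1)])
  moreover have "{x \<in> K. D (h i) x} \<inter> {x \<in> K. D (h j) x} = {x \<in> K. D (h i) x \<and> D (h j) x}"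
    by auto
  ultimately show False
    using ij(2) by (simp add: positive_sets_def)
qed

text \<open>There are at least two indices and \<open>s\<close> is below \<kappa>, so a one-point
  set is smaller than \<kappa> and uniformity applies.\<close>

lemma singleton_in_ideal:
  assumes "uniform_ideal r J" and "s <o r" and "saturated s (Field r) J" and "Card_order r"
    and "x \<in> Field r"
  shows "{x} \<in> J"
proof -
  have id: "ideal_on (Field r) J"
    using assms(1) by (simp add: uniform_ideal_def)
  obtain i j where "i \<in> Field s" "j \<in> Field s" "i \<noteq> j"
    using saturated_length_two[OF assms(3) id] .
  then have "\<not> (\<exists>f. inj_on f (Field s) \<and> f ` Field s \<subseteq> {x})"
    unfolding inj_on_def image_subset_iff singleton_iff by metis
  then have "|{x}| <o |Field s|"
    unfolding card_of_ordLess .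
  also have "|Field s| \<le>o s"
    using assms(2) by (intro card_of_least) (auto simp: ordLess_def)
  also have "s <o r" by fact
  finally show ?thesis
    using assms(1,5) by (auto simp: uniform_ideal_def)
qed

text \<open>
  If \<open>\<kappa>\<close> were countable, the immediate predecessor would be an injective regressive function.
\<close>

lemma uncountable_Field:
  assumes "uniform_ideal r J" and "normal_ideal r J" and "s <o r" and "saturated s (Field r) J"
    and "Card_order r"
  shows "natLeq <o r"
proof (rule ccontr)
  assume "\<not> natLeq <o r"
  have Wr: "Well_order r"
    using assms(5) by (simp add: card_order_on_def)
  have le: "r \<le>o natLeq"
    using \<open>\<not> natLeq <o r\<close> Wr natLeq_Well_order by (simp add: not_ordLess_iff_ordLeq)
  have id: "ideal_on (Field r) J"
    using assms(1) by (simp add: uniform_ideal_def)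
  note sing = singleton_in_ideal[OF assms(1,3,4,5)]
  \<comment> \<open>For \<kappa> at most countable, proper initial segments are finite, so each
    nonempty one has a last element.\<close>
  have fin: "finite (underS r a)" if "a \<in> Field r" for a
    using card_of_underS[OF assms(5) that] le ordLess_ordLeq_trans
    unfolding finite_iff_ordLess_natLeq by blast
  \<comment> \<open>A set without two comparable points has at most one element and is therefore
    null.\<close>
  have ev: "\<forall>\<^sub>F y in dual_as_filter (Field r) J. \<not> P y"
    if "\<And>y z. y \<in> Field r \<Longrightarrow> z \<in> Field r \<Longrightarrow> P y \<Longrightarrow> P z \<Longrightarrow> \<not> slt r y z" for P
  proof -
    have "{y \<in> Field r. P y} \<subseteq> {y}" if "y \<in> Field r" "P y" for y
      using slt_linear[OF Wr] that \<open>\<And>y z. _ \<Longrightarrow> _ \<Longrightarrow> _ \<Longrightarrow> _ \<Longrightarrow> \<not> slt r y z\<close> by blast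
    then have "{y \<in> Field r. P y} = {} \<or> (\<exists>x\<in>Field r. {y \<in> Field r. P y} = {x})"
      by blast
    then have "{y \<in> Field r. P y} \<in> J"
      using sing id by (auto simp: ideal_on_def)
    then show ?thesis
      by (simp add: eventually_dual_as_filter[OF id])
  qed
  define pred where "pred x y \<longleftrightarrow> slt r x y \<and> (\<forall>z. slt r z y \<longrightarrow> \<not> slt r x z)" for x y
  have ex_pred: "\<exists>x. pred x y" if y: "y \<in> Field r" "underS r y \<noteq> {}" for y
  proof -
    have "\<exists>x\<in>underS r y. \<forall>z\<in>underS r y. z \<noteq> x \<longrightarrow> \<not> slt r x z"
      using fin[OF y(1)] _ _ y(2)
    proof (rule Finite_Set.bex_max_element)
      show "asymp_on (underS r y) (slt r)" "transp_on (underS r y) (slt r)"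
        using slt_asym[OF Wr] slt_trans[OF Wr] by (blast intro: asymp_onI transp_onI)+
    qed
    then show ?thesis
      unfolding pred_def slt_iff_underS[of r _ y] by (auto simp: slt_def)
  qed
  \<comment> \<open>Each \<open>x\<close> immediately precedes at most one point, so by normality
    almost no point has an immediate predecessor; yet every non-minimal point has one.\<close>
  have "\<forall>\<^sub>F y in dual_as_filter (Field r) J. \<not> pred x y" for x
    by (rule ev) (auto simp: pred_def)
  then have "\<forall>\<^sub>F y in dual_as_filter (Field r) J. \<forall>x. slt r x y \<longrightarrow> \<not> pred x y"
    by (intro eventually_diagonal_dual[OF id assms(2)])
  moreover have "\<forall>\<^sub>F y in dual_as_filter (Field r) J. \<not> underS r y = {}"
    by (rule ev) (auto simp: slt_iff_underS)
  moreover have "\<forall>\<^sub>F y in dual_as_filter (Field r) J. y \<in> Field r"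
    using id by (simp add: eventually_dual_as_filter ideal_on_def)
  ultimately have "\<forall>\<^sub>F y in dual_as_filter (Field r) J. False"
  proof eventually_elim
    case (elim y)
    then show ?case
      using ex_pred[of y] by (auto simp: pred_def)
  qed
  then show False
    using id by (simp add: eventually_dual_as_filter[OF id] ideal_on_def)
qed

text \<open>The copy of the naturals keeps \<open>M\<close> infinite even if \<gamma> is finite; it
  stays below \<kappa> by \<open>uncountable_Field\<close>.\<close>

lemma saturated_filter_dual:
  assumes "uniform_ideal r J" and "normal_ideal r J" and "s <o r" and "saturated s (Field r) J"
    and "Card_order r"
  shows "saturated_filter r (dual_as_filter (Field r) J) (Field s <+> (UNIV :: nat set))"
proof
  have id: "ideal_on (Field r) J"
    using assms(1) by (simp add: uniform_ideal_def)
  have nat: "|UNIV :: nat set| <o r"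
    using uncountable_Field[OF assms] card_of_nat ordIso_ordLess_trans by blast
  have "|Field s| \<le>o s"
    using assms(3) by (intro card_of_least) (auto simp: ordLess_def)
  then have s: "|Field s| <o r"
    using assms(3) ordLeq_ordLess_trans by blast
  have inf: "infinite (Field r)"
    using uncountable_Field[OF assms] infinite_iff_natLeq_ordLeq[of "Field r"]
      card_of_Field_ordIso[OF assms(5)] ordIso_symmetric ordLess_imp_ordLeq ordLeq_ordIso_trans
    by blast
  show "Card_order r" by fact
  show "infinite (Field s <+> (UNIV :: nat set))"
    by (simp add: finite_Plus_iff)
  show "|Field s <+> (UNIV :: nat set)| <o r"
    using inf assms(5) s nat by (rule card_of_Plus_ordLess_infinite_Field)
  show "\<forall>\<^sub>F x in dual_as_filter (Field r) J. x \<in> Field r"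
    using id by (simp add: eventually_dual_as_filter ideal_on_def)
  show "\<forall>\<^sub>F x in dual_as_filter (Field r) J. x \<notin> X" if "|X| <o r" for X
  proof -
    have "|{x \<in> Field r. x \<in> X}| <o r"
      using that card_of_mono1[of "{x \<in> Field r. x \<in> X}" X] ordLeq_ordLess_trans by blast
    then show ?thesis
      using assms(1) by (simp add: eventually_dual_as_filter[OF id] uniform_ideal_def)
  qed
  show "\<forall>\<^sub>F x in dual_as_filter (Field r) J. \<forall>y. slt r y x \<longrightarrow> P y x"
    if "\<And>y. y \<in> Field r \<Longrightarrow> \<forall>\<^sub>F x in dual_as_filter (Field r) J. P y x" for P
    using id assms(2) that by (rule eventually_diagonal_dual)
  show "|\<Theta>| \<le>o |Field s <+> (UNIV :: nat set)|"
    if "\<Theta> \<subseteq> Field r" "\<And>y. y \<in> \<Theta> \<Longrightarrow> \<exists>\<^sub>F x in dual_as_filter (Field r) J. D y x"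
      "\<And>y z. y \<in> \<Theta> \<Longrightarrow> z \<in> \<Theta> \<Longrightarrow> y \<noteq> z \<Longrightarrow>
        \<forall>\<^sub>F x in dual_as_filter (Field r) J. \<not> (D y x \<and> D z x)" for \<Theta> D
    by (rule ordLeq_transitive[OF card_almost_disjoint_ideal[OF id assms(4) that(2,3)] card_of_Plus1])
qed

subsection \<open>Cohen forcing\<close>

text \<open>The witness is the union of the maps; agreement makes the choice of index in
  \<open>q\<close> immaterial. For \<open>k = 0\<close> it is the empty condition.\<close>

lemma Add_omega_common_extension:
  fixes k :: nat
  assumes p: "\<And>i. i < k \<Longrightarrow> p i \<in> Add_omega t"
    and agree: "\<And>i j x. i < k \<Longrightarrow> j < k \<Longrightarrow> x \<in> dom (p i) \<Longrightarrow> x \<in> dom (p j) \<Longrightarrow> p i x = p j x"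
  obtains q where "q \<in> Add_omega t" "\<And>i. i < k \<Longrightarrow> (q, p i) \<in> Add_omega_le t"
proof -
  define q where "q x = (if \<exists>i<k. x \<in> dom (p i) then p (SOME i. i < k \<and> x \<in> dom (p i)) x else None)"
    for x
  have q: "q x = p i x" if "i < k" "x \<in> dom (p i)" for i x
  proof -
    define j where "j = (SOME i. i < k \<and> x \<in> dom (p i))"
    have "j < k \<and> x \<in> dom (p j)"
      unfolding j_def by (rule someI[of _ i]) (use that in simp)
    moreover have "\<exists>i<k. x \<in> dom (p i)"
      using that by blast
    then have "q x = p j x"
      unfolding q_def j_def by (rule if_P)
    ultimately show ?thesis
      using agree[of j i x] that by simp
  qed
  have "dom q \<subseteq> (\<Union>i<k. dom (p i))"
  proof
    fix x assume "x \<in> dom q"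
    then have "\<exists>i<k. x \<in> dom (p i)"
      unfolding q_def dom_def by (metis (mono_tags, lifting) mem_Collect_eq)
    then show "x \<in> (\<Union>i<k. dom (p i))"
      by blast
  qed
  moreover have "finite (\<Union>i<k. dom (p i))"
    using p by (intro finite_UN_I) (simp_all add: Add_omega_def)
  ultimately have "finite (dom q)"
    by (rule finite_subset)
  moreover have "dom q \<subseteq> Field t \<times> UNIV"
  proof (rule order_trans)
    show "dom q \<subseteq> (\<Union>i<k. dom (p i))" by fact
    show "(\<Union>i<k. dom (p i)) \<subseteq> Field t \<times> UNIV"
      using p by (intro UN_least) (simp add: Add_omega_def)
  qed
  ultimately have "q \<in> Add_omega t"
    by (simp add: Add_omega_def)
  moreover have "p i \<subseteq>\<^sub>m q" if "i < k" for i
    using q[OF that] by (auto simp: map_le_def)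
  ultimately show ?thesis
    using that p by (simp add: Add_omega_le_def)
qed

theorem theorem4p1:
  fixes t :: "'l rel" and r :: "'k rel" and s :: "'g rel"
    and J :: "'k set set" and m n :: nat
  assumes "Card_order t"
    and "Card_order r"
    and "s <o r"
    and "uniform_ideal r J"
    and "normal_ideal r J"
    and "saturated s (Field r) J"
  shows "fubini_linked r J n m (Add_omega t) (Add_omega_le t)"
proof -
  have id: "ideal_on (Field r) J"
    using assms(4) by (simp add: uniform_ideal_def)
  interpret saturated_filter r "dual_as_filter (Field r) J" "Field s <+> (UNIV :: nat set)"
    by (rule saturated_filter_dual[OF assms(4,5,3,6,2)])
  show ?thesis
    unfolding fubini_linked_def
  proof (intro ballI allI impI)
    fix X and p :: "'k list \<Rightarrow> 'l \<times> nat \<rightharpoonup> bool"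
    assume pos: "X \<in> positive_sets (tuples r n) (fubini_power r J n)"
      and p: "\<forall>a\<in>X. p a \<in> Add_omega t"
    have X: "X \<subseteq> tuples r n"
      using pos by (simp add: positive_sets_def)
    have freq: "\<exists>\<^sub>F a in power_filter (dual_as_filter (Field r) J) n. a \<in> X"
      using pos positive_fubini_power_iff[OF id X] by simp
    have fin: "finite (dom (p a))" if "a \<in> X" for a
      using p that by (simp add: Add_omega_def)
    obtain Y where Y: "Y \<subseteq> X" "\<exists>\<^sub>F a in power_filter (dual_as_filter (Field r) J) n. a \<in> Y"
      "\<forall>a\<in>Y. \<forall>b\<in>Y. index_compatible a b \<longrightarrow> (\<forall>x \<in> dom (p a) \<inter> dom (p b). p a x = p b x)"
      by (rule finite_maps_agree[OF freq X fin])
    have YX: "Y \<subseteq> tuples r n"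
      using Y(1) X by (rule order_trans)
    have "Y \<in> positive_sets (tuples r n) (fubini_power r J n)"
      using positive_fubini_power_iff[OF id YX] Y(2) by simp
    moreover have "\<exists>q\<in>Add_omega t. \<forall>i<k. (q, p (a i)) \<in> Add_omega_le t"
      if aY: "\<forall>i<k. a i \<in> Y" and sim: "\<forall>i<k. \<forall>j<k. i \<noteq> j \<longrightarrow> tuple_sim r (a i) (a j)"
      for k and a :: "nat \<Rightarrow> 'k list"
    proof -
      \<comment> \<open>Similarity is given for distinct indices; for equal ones agreement is
        trivial.\<close>
      have agree: "p (a i) x = p (a j) x"
        if "i < k" "j < k" "x \<in> dom (p (a i))" "x \<in> dom (p (a j))" for i j x
      proof (cases "i = j")
        case False
        have "index_compatible (a i) (a j)"
          by (rule tuple_sim_imp_index_compatible[OF Well_order])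
            (use False that aY YX sim in auto)
        then show ?thesis
          using Y(3) aY that by blast
      qed simp
      have "p (a i) \<in> Add_omega t" if "i < k" for i
        using that aY Y(1) p by blast
      then obtain q where "q \<in> Add_omega t" "\<And>i. i < k \<Longrightarrow> (q, p (a i)) \<in> Add_omega_le t"
        using Add_omega_common_extension[of k "\<lambda>i. p (a i)" t, OF _ agree] by blast
      then show ?thesis
        by blast
    qed
    ultimately show "\<exists>Y\<subseteq>X. Y \<in> positive_sets (tuples r n) (fubini_power r J n) \<and>
        (\<forall>k\<le>m. \<forall>a. (\<forall>i<k. a i \<in> Y) \<and>
          (\<forall>i<k. \<forall>j<k. i \<noteq> j \<longrightarrow> tuple_sim r (a i) (a j)) \<longrightarrow>
          (\<exists>q\<in>Add_omega t. \<forall>i<k. (q, p (a i)) \<in> Add_omega_le t))"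
      using Y(1) by (intro exI[of _ Y]) simp
  qed
qed

end
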